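(* Let $d=2k+1$ with $k\ge 1$ an integer, and let $X$ be a set of residues modulo $2d$ (identified with a subset of $[2d]$). Let $$\mathcal{F}(X)=\Big\{F\in\binom{[2d]}{d}:\ \sum_{i\in F} i\in X \pmod{2d}\Big\}.$$ Then $\mathcal{F}(X)$ almost shatters every $S\in\binom{[2d]}{d}$ if and only if the following three conditions hold: (1) $|X|=d$ and $X\cap(d-X)=\emptyset$ modulo $2d$, where $d-X=\{d-x:x\in X\}$; (2) $X$ contains both odd and even elements; (3) for every $u\in X$, $\sum_{w\in X\setminus\{u\}} w\not\equiv 0\pmod d$.
   Context: For a family $\mathcal{F}$ and a set $S$, $\mathcal{F}|_S=\{F\cap S:F\in\mathcal{F}\}$; $\mathcal{F}$ almost shatters $S$ if $\mathcal{F}|_S=2^S\setminus\{\emptyset\}$ or $\mathcal{F}|_S=2^S\setminus\{S\}$. Elements of $[2d]$ are regarded as residues modulo $2d$ (so $2d\equiv 0$). *)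

theory Defs
  imports "HOL-Number_Theory.Cong" "HOL-Library.Ramsey"
begin

definition restrict_family :: "'a set set \<Rightarrow> 'a set \<Rightarrow> 'a set set" where
  "restrict_family \<F> S = (\<lambda>F. F \<inter> S) ` \<F>"

definition almost_shatters :: "'a set set \<Rightarrow> 'a set \<Rightarrow> bool" where
  "almost_shatters \<F> S \<longleftrightarrow> restrict_family \<F> S = Pow S - {{}} \<or> restrict_family \<F> S = Pow S - {S}"

text \<open>
  The ground set is the set of integers from 1 to n, so that its elements can also be
  read as residues modulo n, with n representing the residue 0.
\<close>

definition ground :: "nat \<Rightarrow> int set" where
  "ground n = {1..int n}"

definition sum_family :: "nat \<Rightarrow> int set \<Rightarrow> int set set" where
  "sum_family d X =
     {F \<in> nsets (ground (2 * d)) d. \<exists>x\<in>X. [(\<Sum>i\<in>F. i) = x] (mod int (2 * d))}"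

definition residues_of :: "nat \<Rightarrow> int set \<Rightarrow> int set" where
  "residues_of m A = (\<lambda>a. a mod int m) ` A"

end

theory Submission
  imports Defs
begin

text \<open>
  A \<open>d\<close>-set and its complement in the ground set have sums adding up to \<open>d\<close> modulo \<open>2 d\<close>. So
  exactly one of \<open>{}\<close> and \<open>S\<close> is a trace on every \<open>S\<close> iff \<open>X\<close> contains exactly one of \<open>r\<close> and
  \<open>d - r\<close> for every residue \<open>r\<close>, which is condition (1).

  Let \<open>R\<close> be the complement of \<open>S\<close>, let \<open>T\<close> be a nonempty proper subset of \<open>S\<close>, and put
  \<open>m = d - |T|\<close>. Then \<open>T\<close> is not a trace iff the translate of the set \<open>Y\<close> of all \<open>m\<close>-subset
  sums of \<open>R\<close> by the sum of \<open>T\<close> avoids \<open>X\<close>, that is, \<open>c - Y\<close> is contained in \<open>X\<close> for some \<open>c\<close>.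
  For \<open>m = 1\<close> and \<open>m = d - 1\<close> this forces \<open>X = c - R\<close> or \<open>X = c + R\<close>, and comparing sums yields
  exactly the failure of condition (3).

  For \<open>2 \<le> m \<le> d - 2\<close>, the inclusion forces \<open>|Y| \<le> d\<close>. If every nonzero residue is a
  difference \<open>x - y\<close> of elements of \<open>R\<close>, exchanging \<open>y\<close> for \<open>x\<close> shows that \<open>Y\<close> meets each of its
  nontrivial translates in at least \<open>k + 1\<close> points, and counting pairs in \<open>Y \<times> Y\<close> by their difference
  gives \<open>|Y| > d\<close>. Otherwise \<open>R + \<delta>\<close> is the complement of \<open>R\<close> for some \<open>\<delta>\<close>; iterating \<open>d\<close> times,
  also \<open>R + d\<close> is, so \<open>R\<close> is a transversal modulo \<open>d\<close>. Then \<open>Y\<close> covers all residues modulo \<open>d\<close>, and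
  \<open>|Y| = d\<close> is possible only if all elements of \<open>R\<close> have the same parity. In that case \<open>X = c - Y\<close>
  consists of elements of one parity, contradicting condition (2).
\<close>

section \<open>Sets of residues\<close>

definition mem_mod :: "nat \<Rightarrow> int set \<Rightarrow> int \<Rightarrow> bool" where
  "mem_mod n A r \<longleftrightarrow> (\<exists>x\<in>A. [x = r] (mod int n))"

text \<open>Sums are reduced to \<open>{0..<int n}\<close> so that \<open>card\<close> counts
  residue classes.\<close>

definition subset_sums :: "nat \<Rightarrow> int set \<Rightarrow> nat \<Rightarrow> int set" where
  "subset_sums n A m = (\<lambda>F. (\<Sum>i\<in>F. i) mod int n) ` nsets A m"

lemma mem_mod_cong:
  assumes "[r = s] (mod int n)"
  shows "mem_mod n A r \<longleftrightarrow> mem_mod n A s"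
  using assms unfolding mem_mod_def by (metis cong_sym cong_trans)

lemma mem_mod_iff: "mem_mod n A r \<longleftrightarrow> r mod int n \<in> residues_of n A"
  unfolding mem_mod_def residues_of_def cong_def by (auto simp: image_iff eq_commute)

lemma mod_in_interval: "n > 0 \<Longrightarrow> a mod int n \<in> {0..<int n}"
  by simp

lemma residues_of_subset: "n > 0 \<Longrightarrow> residues_of n A \<subseteq> {0..<int n}"
  unfolding residues_of_def by (auto intro: mod_in_interval)

lemma ground_cong_eq:
  assumes "x \<in> ground n" "y \<in> ground n" "[x = y] (mod int n)"
  shows "x = y"
proof -
  have "int n dvd x - y" using assms(3) by (simp add: cong_iff_dvd_diff)
  moreover have "\<bar>x - y\<bar> < int n" using assms(1,2) unfolding ground_def by auto
  ultimately show ?thesis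
    using zdvd_not_zless[of "\<bar>x - y\<bar>" "int n"] by auto
qed

lemma finite_ground [simp]: "finite (ground n)"
  by (simp add: ground_def)

lemma card_ground [simp]: "card (ground n) = n"
  by (simp add: ground_def)

lemma ground_inj_mod: "A \<subseteq> ground n \<Longrightarrow> inj_on (\<lambda>x. x mod int n) A"
  by (rule inj_onI) (meson cong_def ground_cong_eq subsetD)

lemma card_residues_of: "A \<subseteq> ground n \<Longrightarrow> card (residues_of n A) = card A"
  unfolding residues_of_def by (intro card_image ground_inj_mod)

lemma ex_ground_cong:
  assumes "n > 0"
  obtains x where "x \<in> ground n" "[x = r] (mod int n)"
proof
  \<comment> \<open>Reducing \<open>r - 1\<close> and adding 1 lands between 1 and \<open>n\<close>,
    with \<open>n\<close> representing 0.\<close>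
  show "(r - 1) mod int n + 1 \<in> ground n"
    using zless_imp_add1_zle[OF pos_mod_bound[of "int n" "r - 1"]] pos_mod_sign[of "int n" "r - 1"] assms
    unfolding ground_def by simp
  have "[(r - 1) mod int n + 1 = (r - 1) + 1] (mod int n)"
    by (intro cong_add cong_refl) (simp add: cong_def)
  then show "[(r - 1) mod int n + 1 = r] (mod int n)" by simp
qed

lemma inj_on_affine_mod:
  fixes n :: nat and b c :: int
  assumes "A \<subseteq> {0..<int n}" "c = 1 \<or> c = - 1"
  shows "inj_on (\<lambda>w. (b + c * w) mod int n) A"
proof (rule inj_onI)
  fix x y assume xy: "x \<in> A" "y \<in> A" "(b + c * x) mod int n = (b + c * y) mod int n"
  then have "[b + c * x = b + c * y] (mod int n)" by (simp add: cong_def)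
  then have "int n dvd c * (x - y)" by (simp add: cong_iff_dvd_diff right_diff_distrib)
  then have "int n dvd x - y"
    using assms(2) by (metis dvd_minus_iff mult_1 mult_minus1)
  then have "x mod int n = y mod int n" by (simp add: mod_eq_dvd_iff)
  moreover have "x mod int n = x" "y mod int n = y" using xy assms(1) by (auto intro: mod_pos_pos_trivial)
  ultimately show "x = y" by simp
qed

text \<open>The reflection of \<open>r\<close> to \<open>d - r\<close> preserves the number of
  residues. Two disjoint sets of size \<open>d\<close> partition the \<open>2 * d\<close> residues,
  and a partition into two sets of equal size forces size \<open>d\<close>.\<close>

lemma pair_condition_iff:
  assumes "X \<subseteq> ground (2 * d)" "d > 0"
  shows "(card X = d \<and>
      residues_of (2 * d) X \<inter> residues_of (2 * d) ((\<lambda>x. int d - x) ` X) = {}) \<longleftrightarrow>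
    (\<forall>r. mem_mod (2 * d) X r \<longleftrightarrow> \<not> mem_mod (2 * d) X (int d - r))"
proof -
  let ?n = "2 * d"
  let ?A = "residues_of ?n X" and ?B = "residues_of ?n ((\<lambda>x. int d - x) ` X)"
  have sub: "?A \<subseteq> {0..<int ?n}" "?B \<subseteq> {0..<int ?n}"
    using residues_of_subset[of ?n X] residues_of_subset[of ?n "(\<lambda>x. int d - x) ` X"] assms(2) by simp_all
  then have fin: "finite ?A" "finite ?B" by (meson finite_atLeastLessThan_int finite_subset)+
  have B: "mem_mod ?n X (int d - r) \<longleftrightarrow> r mod int ?n \<in> ?B" for r
  proof -
    have "[x = int d - r] (mod int ?n) \<longleftrightarrow> [int d - x = r] (mod int ?n)" for x
      using dvd_minus_iff[of "int ?n" "x - (int d - r)"]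
      by (simp add: cong_iff_dvd_diff algebra_simps)
    then show ?thesis
      unfolding mem_mod_iff[symmetric] unfolding mem_mod_def by simp
  qed
  have cA: "card ?A = card X" by (rule card_residues_of[OF assms(1)])
  have B_img: "?B = (\<lambda>w. (int d + (-1) * w) mod int ?n) ` ?A"
    unfolding residues_of_def image_image by (simp add: mod_simps)
  have cB: "card ?B = card X"
    unfolding B_img cA[symmetric] by (intro card_image inj_on_affine_mod sub) simp
  have "(card X = d \<and> ?A \<inter> ?B = {}) \<longleftrightarrow> (?A \<inter> ?B = {} \<and> ?A \<union> ?B = {0..<int ?n})"
  proof
    assume "card X = d \<and> ?A \<inter> ?B = {}"
    then have "card (?A \<union> ?B) = card {0..<int ?n}"
      using card_Un_disjoint[OF fin] cA cB by simp
    with \<open>card X = d \<and> ?A \<inter> ?B = {}\<close> sub show "?A \<inter> ?B = {} \<and> ?A \<union> ?B = {0..<int ?n}"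
      by (metis Un_least card_subset_eq finite_atLeastLessThan_int)
  next
    assume "?A \<inter> ?B = {} \<and> ?A \<union> ?B = {0..<int ?n}"
    then show "card X = d \<and> ?A \<inter> ?B = {}"
      using card_Un_disjoint[OF fin] cA cB by simp
  qed
  also have "\<dots> \<longleftrightarrow> (\<forall>r\<in>{0..<int ?n}. r \<in> ?A \<longleftrightarrow> r \<notin> ?B)"
    using sub by blast
  also have "\<dots> \<longleftrightarrow> (\<forall>r. r mod int ?n \<in> ?A \<longleftrightarrow> r mod int ?n \<notin> ?B)"
  proof (rule iffI, rule allI)
    fix r
    assume "\<forall>r\<in>{0..<int ?n}. r \<in> ?A \<longleftrightarrow> r \<notin> ?B"
    moreover have "r mod int ?n \<in> {0..<int ?n}" using mod_in_interval[of ?n r] assms(2) by simp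
    ultimately show "r mod int ?n \<in> ?A \<longleftrightarrow> r mod int ?n \<notin> ?B" by blast
  next
    assume *: "\<forall>r. r mod int ?n \<in> ?A \<longleftrightarrow> r mod int ?n \<notin> ?B"
    show "\<forall>r\<in>{0..<int ?n}. r \<in> ?A \<longleftrightarrow> r \<notin> ?B"
    proof
      fix r assume "r \<in> {0..<int ?n}"
      then have "r mod int ?n = r" by auto
      with *[rule_format, of r] show "r \<in> ?A \<longleftrightarrow> r \<notin> ?B" by simp
    qed
  qed
  finally show ?thesis by (simp only: B flip: mem_mod_iff)
qed

section \<open>Traces and subset sums\<close>

lemma ground_sum: "[(\<Sum>i\<in>ground (2 * d). i) = int d] (mod int (2 * d))"
proof -
  have "(\<Sum>i\<in>{1..int m}. i) * 2 = int m * (int m + 1)" for m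
  proof (induction m)
    case (Suc m)
    have "{1..int (Suc m)} = insert (int m + 1) {1..int m}" by auto
    then show ?case using Suc by (simp add: algebra_simps)
  qed simp
  from this[of "2 * d"] have "(\<Sum>i\<in>ground (2 * d). i) = int d + int d * int (2 * d)"
    unfolding ground_def by (simp add: algebra_simps)
  then show ?thesis by (simp add: cong_def)
qed

text \<open>A member with trace \<open>T\<close> on \<open>S\<close> is \<open>T\<close> together
  with a subset \<open>B\<close> of the complement of \<open>S\<close>; its size \<open>d\<close>
  fixes \<open>card B\<close>.\<close>

lemma restrict_sum_family_iff:
  assumes S: "S \<in> nsets (ground (2 * d)) d" and T: "T \<subseteq> S"
  shows "T \<in> restrict_family (sum_family d X) S \<longleftrightarrow>
    (\<exists>B\<in>nsets (ground (2 * d) - S) (d - card T). mem_mod (2 * d) X ((\<Sum>i\<in>T. i) + (\<Sum>i\<in>B. i)))"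
    (is "?L \<longleftrightarrow> ?R")
proof -
  let ?G = "ground (2 * d)"
  have finS: "finite S" "card S = d" "S \<subseteq> ?G" using S by (auto simp: nsets_def)
  have finT: "finite T" "card T \<le> d" using T finS finite_subset card_mono by auto
  show ?thesis
  proof
    assume ?L
    then obtain F x where F: "F \<subseteq> ?G" "finite F" "card F = d" "F \<inter> S = T" "x \<in> X"
      "[(\<Sum>i\<in>F. i) = x] (mod int (2 * d))"
      unfolding restrict_family_def sum_family_def nsets_def by auto
    have "F = T \<union> (F - S)" "T \<inter> (F - S) = {}" using F by auto
    then have "(\<Sum>i\<in>F. i) = (\<Sum>i\<in>T. i) + (\<Sum>i\<in>F - S. i)" "card F = card T + card (F - S)"
      using sum.union_disjoint[of T "F - S" "\<lambda>i. i"] card_Un_disjoint[of T "F - S"] finT F(2)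
      by simp_all
    then have "card (F - S) = d - card T"
      and "[x = (\<Sum>i\<in>T. i) + (\<Sum>i\<in>F - S. i)] (mod int (2 * d))"
      using F(3,6) by (simp, metis cong_sym)
    moreover have "F - S \<in> nsets (?G - S) (card (F - S))" using F(1,2) by (auto simp: nsets_def)
    ultimately show ?R using F(5) unfolding mem_mod_def by metis
  next
    assume ?R
    then obtain B x where B: "B \<subseteq> ?G - S" "finite B" "card B = d - card T" "x \<in> X"
      "[x = (\<Sum>i\<in>T. i) + (\<Sum>i\<in>B. i)] (mod int (2 * d))"
      unfolding mem_mod_def nsets_def by auto
    have "T \<inter> B = {}" using B T by auto
    then have "(\<Sum>i\<in>T \<union> B. i) = (\<Sum>i\<in>T. i) + (\<Sum>i\<in>B. i)" "card (T \<union> B) = d"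
      using finT B by (auto simp: sum.union_disjoint card_Un_disjoint)
    then have "T \<union> B \<in> sum_family d X"
      using B T finT finS unfolding sum_family_def nsets_def by (auto intro: cong_sym)
    moreover have "(T \<union> B) \<inter> S = T" using B T by auto
    ultimately show ?L unfolding restrict_family_def by (metis imageI)
  qed
qed

lemma restrict_family_subset: "restrict_family \<F> S \<subseteq> Pow S"
  unfolding restrict_family_def by auto

lemma complement_nsets:
  assumes "S \<in> nsets (ground (2 * d)) d"
  shows "ground (2 * d) - S \<in> nsets (ground (2 * d)) d"
    and "[(\<Sum>i\<in>ground (2 * d) - S. i) = int d - (\<Sum>i\<in>S. i)] (mod int (2 * d))"
proof -
  have S: "S \<subseteq> ground (2 * d)" "finite S" "card S = d"
    using assms by (simp_all add: nsets_def)
  have "card (ground (2 * d) - S) = d"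
    using card_Diff_subset[OF S(2,1)] S(3) by simp
  then show "ground (2 * d) - S \<in> nsets (ground (2 * d)) d"
    by (simp add: nsets_def)
  have "(\<Sum>i\<in>ground (2 * d) - S. i) = (\<Sum>i\<in>ground (2 * d). i) - (\<Sum>i\<in>S. i)"
    using S(1) by (simp add: sum_diff)
  then show "[(\<Sum>i\<in>ground (2 * d) - S. i) = int d - (\<Sum>i\<in>S. i)] (mod int (2 * d))"
    using cong_diff[OF ground_sum cong_refl] by simp
qed

lemma nsets_card_self: "finite A \<Longrightarrow> nsets A (card A) = {A}"
  unfolding nsets_def using card_subset_eq by blast

lemma whole_in_restrict_iff:
  assumes S: "S \<in> nsets (ground (2 * d)) d"
  shows "S \<in> restrict_family (sum_family d X) S \<longleftrightarrow> mem_mod (2 * d) X (\<Sum>i\<in>S. i)"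
proof -
  have "card S = d" using S by (simp add: nsets_def)
  then show ?thesis
    unfolding restrict_sum_family_iff[OF S order_refl] by simp
qed

text \<open>The only \<open>d\<close>-set disjoint from \<open>S\<close> is its complement.\<close>

lemma empty_in_restrict_iff:
  assumes S: "S \<in> nsets (ground (2 * d)) d"
  shows "{} \<in> restrict_family (sum_family d X) S \<longleftrightarrow> mem_mod (2 * d) X (int d - (\<Sum>i\<in>S. i))"
proof -
  let ?R = "ground (2 * d) - S"
  have "card ?R = d" using complement_nsets(1)[OF S] by (simp add: nsets_def)
  then have "nsets ?R (d - card ({} :: int set)) = {?R}"
    using nsets_card_self[of ?R] by simp
  then have "{} \<in> restrict_family (sum_family d X) S \<longleftrightarrow> mem_mod (2 * d) X (\<Sum>i\<in>?R. i)"
    unfolding restrict_sum_family_iff[OF S empty_subsetI] by simp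
  then show ?thesis
    using mem_mod_cong[OF complement_nsets(2)[OF S]] by simp
qed

section \<open>Subset sums of initial segments\<close>

text \<open>Here \<open>e\<close> is the excess over the smallest sum of \<open>m\<close> elements.
  In the induction, the new largest element \<open>N\<close> is left out if smaller elements can
  still realise the excess, and is put into \<open>F\<close> otherwise.\<close>

lemma consecutive_subset_sums:
  fixes N m e :: nat
  assumes "m \<le> N" "e \<le> m * (N - m)"
  shows "\<exists>F \<subseteq> {..<N}. card F = m \<and> \<Sum>F = \<Sum>{..<m} + e"
  using assms
proof (induction N arbitrary: m e)
  case 0
  then show ?case by simp
next
  case (Suc N)
  show ?case
  proof (cases "m \<le> N \<and> e \<le> m * (N - m)")
    case True
    then obtain F where "F \<subseteq> {..<N}" "card F = m" "\<Sum>F = \<Sum>{..<m} + e"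
      using Suc.IH by blast
    then show ?thesis by (intro exI[of _ F]) auto
  next
    case False
    then obtain j where j: "m = Suc j" using Suc.prems by (cases m) auto
    have jN: "j \<le> N" using Suc.prems j by simp
    then obtain t where t: "N = j + t" using le_Suc_ex by blast
    \<comment> \<open>Replacing \<open>j\<close> by \<open>N\<close> in the smallest
      \<open>m\<close>-set uses up \<open>t = N - j\<close> of the excess; as \<open>N\<close> could
      not be left out, \<open>e\<close> is large enough for that.\<close>
    have te: "t \<le> e"
    proof (cases t)
      case (Suc s)
      then have "m \<le> N" "N - m = s" using j t by simp_all
      then have "e > m * s" using False by simp
      moreover have "m * s \<ge> s" using j by simp
      ultimately show ?thesis using Suc by linarith
    qed simp
    have "e \<le> Suc j * t" using Suc.prems(2) j t by simp
    then have "e - t \<le> j * (N - j)" using t by simp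
    then obtain F where F: "F \<subseteq> {..<N}" "card F = j" "\<Sum>F = \<Sum>{..<j} + (e - t)"
      using Suc.IH[OF jN] by blast
    have "finite F" "N \<notin> F" using F finite_subset by auto
    then have "card (insert N F) = m" "\<Sum>(insert N F) = N + \<Sum>F"
      using F(2) j by simp_all
    moreover have "N + \<Sum>F = \<Sum>{..<m} + e"
      using F(3) te unfolding j t lessThan_Suc by simp
    moreover have "insert N F \<subseteq> {..<Suc N}" using F(1) by auto
    ultimately show ?thesis by metis
  qed
qed

text \<open>The attainable sums fill an interval of \<open>m * (N - m) + 1\<close> integers, which
  meets every class modulo \<open>n\<close> once it has at least \<open>n\<close> elements.\<close>

lemma ex_consecutive_sum_cong:
  fixes N m n :: nat and r :: int
  assumes "m \<le> N" "n > 0" "n \<le> m * (N - m) + 1"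
  shows "\<exists>F \<subseteq> {..<N}. card F = m \<and> [int (\<Sum>F) = r] (mod int n)"
proof -
  define e where "e = nat ((r - int (\<Sum>{..<m})) mod int n)"
  have e: "int e = (r - int (\<Sum>{..<m})) mod int n" using assms(2) by (simp add: e_def)
  moreover have "(r - int (\<Sum>{..<m})) mod int n < int n" using assms(2) by simp
  ultimately have "e < n" by linarith
  then have "e \<le> m * (N - m)" using assms(3) by simp
  then obtain F where F: "F \<subseteq> {..<N}" "card F = m" "\<Sum>F = \<Sum>{..<m} + e"
    using consecutive_subset_sums[OF assms(1)] by blast
  have "[int (\<Sum>{..<m}) + int e = int (\<Sum>{..<m}) + (r - int (\<Sum>{..<m}))] (mod int n)"
    unfolding e by (intro cong_add cong_refl) (simp add: cong_def)
  then show ?thesis using F by (intro exI[of _ F]) (simp del: of_nat_sum)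
qed

text \<open>Turns information about all \<open>S\<close> into information about all
  residues.\<close>

lemma ex_nsets_ground_sum:
  assumes "d \<ge> 1"
  obtains S where "S \<in> nsets (ground (2 * d)) d" "[(\<Sum>i\<in>S. i) = r] (mod int (2 * d))"
proof -
  have "2 * d \<le> d * d + 1" using assms
    by (cases d) (auto simp: algebra_simps)
  \<comment> \<open>The target is \<open>r - d\<close> because passing from 0-based to 1-based
    elements adds 1 to each of the \<open>d\<close> elements.\<close>
  then obtain F where F: "F \<subseteq> {..<2 * d}" "card F = d"
    "[int (\<Sum>F) = r - int d] (mod int (2 * d))"
    using ex_consecutive_sum_cong[of d "2 * d" "2 * d" "r - int d"] assms by auto
  let ?S = "(\<lambda>i. int i + 1) ` F"
  have inj: "inj_on (\<lambda>i. int i + 1) F" by (auto simp: inj_on_def)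
  have "finite F" using F finite_subset by blast
  then have "?S \<in> nsets (ground (2 * d)) d"
    using F inj by (auto simp: nsets_def ground_def card_image)
  moreover have "(\<Sum>i\<in>?S. i) = int (\<Sum>F) + int d"
    using F inj by (simp add: sum.reindex sum.distrib)
  then have "[(\<Sum>i\<in>?S. i) = (r - int d) + int d] (mod int (2 * d))"
    using F by (metis cong_add cong_refl)
  ultimately show ?thesis using that by simp
qed

section \<open>Half-size sets all of whose differences occur\<close>

lemma subset_sums_subset: "n > 0 \<Longrightarrow> subset_sums n A m \<subseteq> {0..<int n}"
  unfolding subset_sums_def by (auto intro: mod_in_interval)

lemma finite_subset_sums: "n > 0 \<Longrightarrow> finite (subset_sums n A m)"
  by (rule finite_subset[OF subset_sums_subset]) simp_all

lemma inj_on_shift_ground_mod: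
  assumes "A \<subseteq> ground n" "c = 1 \<or> c = - 1"
  shows "inj_on (\<lambda>a. (b + c * a) mod int n) A"
proof (rule inj_onI)
  fix x y assume xy: "x \<in> A" "y \<in> A" "(b + c * x) mod int n = (b + c * y) mod int n"
  then have "int n dvd c * (x - y)" by (simp add: mod_eq_dvd_iff right_diff_distrib)
  then have "int n dvd x - y"
    using assms(2) by (metis dvd_minus_iff mult_1 mult_minus1)
  then have "[x = y] (mod int n)" by (simp add: cong_iff_dvd_diff)
  then show "x = y" using xy assms(1) ground_cong_eq by blast
qed

text \<open>Fixing \<open>j - 1\<close> elements and varying the last one gives distinct
  sums.\<close>

lemma card_subset_sums_extend:
  assumes "A \<subseteq> ground n" "n > 0" "1 \<le> j" "j \<le> card A"
  shows "card A - j + 1 \<le> card (subset_sums n A j)"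
proof -
  have finA: "finite A" using assms(1) finite_subset by fastforce
  obtain C where C: "C \<subseteq> A" "card C = j - 1" "finite C"
    using obtain_subset_with_card_n[of "j - 1" A] assms(4) by (metis diff_le_self le_trans)
  let ?f = "\<lambda>a. ((\<Sum>i\<in>C. i) + 1 * a) mod int n"
  have "?f ` (A - C) \<subseteq> subset_sums n A j"
  proof
    fix s assume "s \<in> ?f ` (A - C)"
    then obtain a where a: "a \<in> A - C" "s = ?f a" by blast
    then have "insert a C \<in> nsets A j" "(\<Sum>i\<in>insert a C. i) = (\<Sum>i\<in>C. i) + a"
      using C assms(3) by (auto simp: nsets_def)
    then show "s \<in> subset_sums n A j" unfolding subset_sums_def a(2) by force
  qed
  then have "card (?f ` (A - C)) \<le> card (subset_sums n A j)"
    using finite_subset_sums assms(2) card_mono by blast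
  moreover have "card (?f ` (A - C)) = card (A - C)"
    using assms(1) by (intro card_image inj_on_shift_ground_mod) auto
  moreover have "card (A - C) = card A - (j - 1)" using C by (simp add: card_Diff_subset)
  ultimately show ?thesis using assms(3,4) by simp
qed

text \<open>Dropping one element from a fixed set of \<open>j + 1\<close> elements gives distinct
  sums; this bound is the better one for large \<open>j\<close>.\<close>

lemma card_subset_sums_omit:
  assumes "A \<subseteq> ground n" "n > 0" "j < card A"
  shows "j + 1 \<le> card (subset_sums n A j)"
proof -
  obtain C where C: "C \<subseteq> A" "card C = j + 1" "finite C"
    using obtain_subset_with_card_n[of "j + 1" A] assms(3) by (metis Suc_eq_plus1 Suc_leI)
  let ?f = "\<lambda>a. ((\<Sum>i\<in>C. i) + (- 1) * a) mod int n"
  have "?f ` C \<subseteq> subset_sums n A j"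
  proof
    fix s assume "s \<in> ?f ` C"
    then obtain a where a: "a \<in> C" "s = ?f a" by blast
    then have "C - {a} \<in> nsets A j" "(\<Sum>i\<in>C - {a}. i) = (\<Sum>i\<in>C. i) + (- 1) * a"
      using C by (auto simp: nsets_def sum_diff1)
    then show "s \<in> subset_sums n A j" unfolding subset_sums_def a(2) by (metis imageI)
  qed
  then have "card (?f ` C) \<le> card (subset_sums n A j)"
    using finite_subset_sums assms(2) card_mono by blast
  moreover have "card (?f ` C) = card C"
    using assms(1) C(1) by (intro card_image inj_on_shift_ground_mod) auto
  ultimately show ?thesis using C(2) by simp
qed

text \<open>A sum \<open>w\<close> of \<open>m - 1\<close> elements avoiding \<open>x\<close> and
  \<open>y\<close> extends by \<open>y\<close> or by \<open>x\<close>, and the two results differ by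
  \<open>\<delta>\<close>; distinct \<open>w\<close> give distinct \<open>y + w\<close>.\<close>

lemma card_subset_sums_shift_inter:
  assumes R: "R \<subseteq> ground n" "n > 0" and "1 \<le> m"
    and xy: "x \<in> R" "y \<in> R" "x \<noteq> y" "[x - y = \<delta>] (mod int n)"
  shows "card (subset_sums n (R - {x, y}) (m - 1)) \<le>
    card {s \<in> subset_sums n R m. (s + \<delta>) mod int n \<in> subset_sums n R m}"
proof -
  let ?W = "subset_sums n (R - {x, y}) (m - 1)" and ?Y = "subset_sums n R m"
  let ?f = "\<lambda>w. (y + 1 * w) mod int n"
  have add: "(z + w) mod int n \<in> ?Y" if w: "w \<in> ?W" and z: "z \<in> {x, y}" for w z
  proof -
    obtain F where F: "F \<in> nsets (R - {x, y}) (m - 1)" "w = (\<Sum>i\<in>F. i) mod int n"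
      using w unfolding subset_sums_def by blast
    have "z \<notin> F" "finite F" using F z by (auto simp: nsets_def)
    then have "(\<Sum>i\<in>insert z F. i) = z + (\<Sum>i\<in>F. i)" "insert z F \<in> nsets R m"
      using F(1) z xy \<open>1 \<le> m\<close> by (auto simp: nsets_def)
    then show ?thesis unfolding subset_sums_def F(2) by (force simp: mod_simps)
  qed
  have "?f ` ?W \<subseteq> {s \<in> ?Y. (s + \<delta>) mod int n \<in> ?Y}"
  proof
    fix s assume "s \<in> ?f ` ?W"
    then obtain w where w: "w \<in> ?W" "s = (y + w) mod int n" by auto
    have "[s + \<delta> = (y + w) + (x - y)] (mod int n)"
      unfolding w(2) using xy(4) by (intro cong_add) (simp_all add: cong_def)
    then have "(s + \<delta>) mod int n = (x + w) mod int n" by (simp add: cong_def algebra_simps)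
    then show "s \<in> {s \<in> ?Y. (s + \<delta>) mod int n \<in> ?Y}" using add w by simp
  qed
  then have "card (?f ` ?W) \<le> card {s \<in> ?Y. (s + \<delta>) mod int n \<in> ?Y}"
    using finite_subset_sums[OF R(2), of R m] by (intro card_mono) simp_all
  moreover have "card (?f ` ?W) = card ?W"
    using subset_sums_subset R(2) by (intro card_image inj_on_affine_mod) auto
  ultimately show ?thesis by simp
qed

text \<open>Double counting: the pairs of \<open>s\<close> and \<open>s + \<delta>\<close> are
  distinct elements of \<open>Y \<times> Y\<close>. The zero shift is left out, hence the factor
  \<open>n - 1\<close>.\<close>

lemma card_square_ge_shifts:
  fixes n c :: nat
  assumes Y: "Y \<subseteq> {0..<int n}"
    and c: "\<And>\<delta>. \<delta> \<in> {1..<int n} \<Longrightarrow> c \<le> card {s \<in> Y. (s + \<delta>) mod int n \<in> Y}"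
  shows "(n - 1) * c \<le> card Y * card Y"
proof -
  have finY: "finite Y" using Y finite_subset by blast
  let ?P = "\<lambda>\<delta>. {s \<in> Y. (s + \<delta>) mod int n \<in> Y}"
  let ?f = "\<lambda>(\<delta>, s). (s, (s + \<delta>) mod int n)"
  have inj: "inj_on ?f (Sigma {1..<int n} ?P)"
  proof (rule inj_onI, clarify)
    fix \<delta> s \<delta>' :: int
    assume \<delta>: "\<delta> \<in> {1..<int n}" "\<delta>' \<in> {1..<int n}" and "(s + \<delta>) mod int n = (s + \<delta>') mod int n"
    then have "int n dvd \<delta> - \<delta>'" by (simp add: mod_eq_dvd_iff)
    then have "\<delta> mod int n = \<delta>' mod int n" by (simp add: mod_eq_dvd_iff)
    then show "\<delta> = \<delta>' \<and> s = s" using \<delta> by simp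
  qed
  have "(n - 1) * c = (\<Sum>\<delta>\<in>{1..<int n}. c)" by (simp add: nat_diff_distrib')
  also have "\<dots> \<le> (\<Sum>\<delta>\<in>{1..<int n}. card (?P \<delta>))" by (intro sum_mono c)
  also have "\<dots> = card (Sigma {1..<int n} ?P)" using finY by simp
  also have "\<dots> = card (?f ` Sigma {1..<int n} ?P)" using inj by (simp add: card_image)
  also have "\<dots> \<le> card (Y \<times> Y)" using finY by (intro card_mono) auto
  finally show ?thesis by (simp add: card_cartesian_product)
qed

text \<open>With \<open>x\<close> and \<open>y\<close> removed, the two bounds on the number of sums
  of \<open>m - 1\<close> elements are \<open>d - m\<close> and \<open>m\<close>, the larger being
  at least \<open>k + 1\<close>. At most \<open>d\<close> sums would then give
  \<open>(4 * k + 1) * (k + 1) \<le> (2 * k + 1) * (2 * k + 1)\<close>, which fails by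
  \<open>k\<close>.\<close>

lemma card_subset_sums_all_differences:
  fixes d k m :: nat
  assumes d: "d = 2 * k + 1" and R: "R \<subseteq> ground (2 * d)" "card R = d"
    and m: "2 \<le> m" "m \<le> d - 2"
    and diff: "\<And>\<delta>. \<delta> \<in> {1..<int (2 * d)} \<Longrightarrow> \<exists>x\<in>R. \<exists>y\<in>R. [x - y = \<delta>] (mod int (2 * d))"
  shows "d < card (subset_sums (2 * d) R m)"
proof (rule ccontr)
  let ?Y = "subset_sums (2 * d) R m"
  assume "\<not> d < card ?Y"
  have k: "k \<ge> 1" using m d by simp
  have n: "2 * d > 0" using d by simp
  have "k + 1 \<le> card {s \<in> ?Y. (s + \<delta>) mod int (2 * d) \<in> ?Y}" if \<delta>: "\<delta> \<in> {1..<int (2 * d)}" for \<delta>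
  proof -
    obtain x y where xy: "x \<in> R" "y \<in> R" "[x - y = \<delta>] (mod int (2 * d))" using diff[OF \<delta>] by blast
    have "x \<noteq> y"
    proof
      assume "x = y"
      then have "int (2 * d) dvd \<delta>" using xy(3) by (simp add: cong_iff_dvd_diff)
      then show False using \<delta> zdvd_not_zless by auto
    qed
    let ?A = "R - {x, y}"
    have A: "?A \<subseteq> ground (2 * d)" "card ?A = d - 2"
      using R xy \<open>x \<noteq> y\<close> by (auto simp: card_Diff_subset)
    have "d - m \<le> card (subset_sums (2 * d) ?A (m - 1))" "m \<le> card (subset_sums (2 * d) ?A (m - 1))"
      using card_subset_sums_extend[OF A(1) n, of "m - 1"] card_subset_sums_omit[OF A(1) n, of "m - 1"]
        A(2) m by linarith+
    then have "k + 1 \<le> card (subset_sums (2 * d) ?A (m - 1))" using d by linarith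
    also have "\<dots> \<le> card {s \<in> ?Y. (s + \<delta>) mod int (2 * d) \<in> ?Y}"
      using R(1) n m xy \<open>x \<noteq> y\<close> by (intro card_subset_sums_shift_inter) auto
    finally show ?thesis .
  qed
  from card_square_ge_shifts[OF subset_sums_subset[OF n] this]
  have "(2 * d - 1) * (k + 1) \<le> card ?Y * card ?Y" .
  also have "\<dots> \<le> d * d" using \<open>\<not> d < card ?Y\<close> by (intro mult_le_mono) simp_all
  finally have "(4 * k + 1) * (k + 1) \<le> (2 * k + 1) * (2 * k + 1)" using d by simp
  then show False using k by (simp add: algebra_simps)
qed

text \<open>If \<open>\<delta>\<close> is not a difference, \<open>R\<close> and its translate by
  \<open>\<delta>\<close> are disjoint halves of the residues, so adding \<open>\<delta>\<close>
  flips membership in \<open>R\<close>. An odd number \<open>d\<close> of flips is again a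
  flip.\<close>

lemma half_set_cases:
  assumes d: "odd d" and R: "R \<subseteq> ground (2 * d)" "card R = d"
  obtains (all_differences)
    "\<And>\<delta>. \<delta> \<in> {1..<int (2 * d)} \<Longrightarrow> \<exists>x\<in>R. \<exists>y\<in>R. [x - y = \<delta>] (mod int (2 * d))"
  | (transversal) "inj_on (\<lambda>x. x mod int d) R"
proof (cases "\<forall>\<delta>\<in>{1..<int (2 * d)}. \<exists>x\<in>R. \<exists>y\<in>R. [x - y = \<delta>] (mod int (2 * d))")
  case True
  then show ?thesis using all_differences by blast
next
  case False
  then obtain \<delta> where \<delta>: "\<And>x y. x \<in> R \<Longrightarrow> y \<in> R \<Longrightarrow> \<not> [x - y = \<delta>] (mod int (2 * d))" by blast
  let ?n = "2 * d"
  let ?P = "mem_mod ?n R" and ?A = "residues_of ?n R"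
  let ?B = "(\<lambda>w. (\<delta> + 1 * w) mod int ?n) ` ?A"
  have n: "?n > 0" using d by (auto intro: odd_pos)
  have sub: "?A \<subseteq> {0..<int ?n}" by (rule residues_of_subset[OF n])
  have disj: "?A \<inter> ?B = {}"
  proof (rule ccontr)
    assume "?A \<inter> ?B \<noteq> {}"
    then obtain x y where "x \<in> R" "y \<in> R" "x mod int ?n = (\<delta> + y mod int ?n) mod int ?n"
      unfolding residues_of_def by auto
    then have "[x - y = \<delta>] (mod int ?n)"
      by (simp add: mod_simps mod_eq_dvd_iff cong_iff_dvd_diff algebra_simps)
    then show False using \<delta> \<open>x \<in> R\<close> \<open>y \<in> R\<close> by blast
  qed
  have cA: "card ?A = d" using card_residues_of[OF R(1)] R(2) by simp
  have cB: "card ?B = d"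
    using card_image[OF inj_on_affine_mod[OF sub, of 1 \<delta>]] cA by simp
  have Bsub: "?B \<subseteq> {0..<int ?n}" using mod_in_interval[OF n] by auto
  have fin: "finite ?A" "finite ?B" using sub finite_subset by blast+
  have "card (?A \<union> ?B) = card {0..<int ?n}"
    using card_Un_disjoint[OF fin disj] cA cB by simp
  then have un: "?A \<union> ?B = {0..<int ?n}"
    using sub Bsub by (metis Un_least card_subset_eq finite_atLeastLessThan_int)
  have shift: "?P (r + \<delta>) \<longleftrightarrow> \<not> ?P r" for r
  proof -
    have "(r + \<delta>) mod int ?n \<in> ?B \<longleftrightarrow> ?P r"
    proof
      assume "(r + \<delta>) mod int ?n \<in> ?B"
      then obtain y where "y \<in> R" "(r + \<delta>) mod int ?n = (\<delta> + y mod int ?n) mod int ?n"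
        unfolding residues_of_def by auto
      then have "[y = r] (mod int ?n)"
        using dvd_minus_iff[of "int ?n" "y - r"]
        by (simp add: mod_simps mod_eq_dvd_iff cong_iff_dvd_diff algebra_simps)
      then show "?P r" using \<open>y \<in> R\<close> unfolding mem_mod_def by blast
    next
      assume "?P r"
      then have "(\<delta> + 1 * (r mod int ?n)) mod int ?n \<in> ?B" unfolding mem_mod_iff by blast
      then show "(r + \<delta>) mod int ?n \<in> ?B" by (simp add: mod_simps add.commute)
    qed
    moreover have "(r + \<delta>) mod int ?n \<in> ?A \<union> ?B" using un mod_in_interval[OF n] by simp
    ultimately show ?thesis using disj unfolding mem_mod_iff by blast
  qed
  have iter: "?P (r + int j * \<delta>) \<longleftrightarrow> (if even j then ?P r else \<not> ?P r)" for r j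
  proof (induction j)
    case (Suc j)
    have "r + int (Suc j) * \<delta> = (r + int j * \<delta>) + \<delta>" by (simp add: algebra_simps)
    show ?case unfolding \<open>r + int (Suc j) * \<delta> = _\<close> shift Suc by simp
  qed simp
  have neg: "?P (r + int d * \<delta>) \<longleftrightarrow> \<not> ?P r" for r using iter[of r d] d by simp
  \<comment> \<open>For even \<open>\<delta>\<close>, \<open>d * \<delta>\<close> vanishes modulo
    \<open>2 * d\<close>, and a zero shift cannot flip membership. For odd \<open>\<delta>\<close>
    it is congruent to \<open>d\<close>.\<close>
  have "odd \<delta>"
  proof
    assume "even \<delta>"
    then have "[0 + int d * \<delta> = 0] (mod int ?n)" by (auto simp: cong_iff_dvd_diff)
    then show False using neg[of 0] mem_mod_cong by blast
  qed
  then obtain e where e: "\<delta> = 2 * e + 1" by (elim oddE)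
  have half: "?P (r + int d) \<longleftrightarrow> \<not> ?P r" for r
  proof -
    have "[r + int d * \<delta> = r + int d] (mod int ?n)"
      unfolding e by (simp add: cong_iff_dvd_diff algebra_simps)
    then show ?thesis using neg[of r] mem_mod_cong by blast
  qed
  have "inj_on (\<lambda>x. x mod int d) R"
  proof (rule inj_onI)
    fix x y assume xy: "x \<in> R" "y \<in> R" "x mod int d = y mod int d"
    then obtain c where c: "x = y + int d * c" by (metis mod_eq_dvd_iff dvdE add.commute diff_add_cancel)
    show "x = y"
    \<comment> \<open>An even multiple of \<open>d\<close> is zero modulo \<open>2 * d\<close>; an
      odd one is congruent to \<open>d\<close>, and a shift by \<open>d\<close> flips
      membership.\<close>
    proof (cases "even c")
      case True
      then have "[x = y] (mod int ?n)" unfolding c by (auto simp: cong_iff_dvd_diff)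
      then show ?thesis using xy R(1) ground_cong_eq by blast
    next
      case False
      then obtain e where e: "c = 2 * e + 1" by (elim oddE)
      have "[x = y + int d] (mod int ?n)" unfolding c e by (simp add: cong_iff_dvd_diff algebra_simps)
      then have "?P (y + int d)" using xy(1) unfolding mem_mod_def by blast
      moreover have "?P y" using xy(2) unfolding mem_mod_def by (meson cong_refl)
      ultimately show ?thesis using half by blast
    qed
  qed
  then show ?thesis by (rule transversal)
qed

section \<open>Transversals modulo \<open>d\<close>\<close>

text \<open>As a periodic function on all integers, \<open>\<rho>\<close> allows \<open>R\<close> to
  be walked through cyclically.\<close>

lemma transversal_section:
  fixes d :: nat
  assumes d: "d > 0" and R: "inj_on (\<lambda>x. x mod int d) R" "card R = d"
  obtains \<rho> :: "int \<Rightarrow> int" where "\<And>x. \<rho> x \<in> R" "\<And>x. [\<rho> x = x] (mod int d)"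
    "\<And>r. r \<in> R \<Longrightarrow> \<rho> r = r" "\<And>x y. \<rho> x = \<rho> y \<longleftrightarrow> [x = y] (mod int d)"
proof -
  let ?p = "\<lambda>x. x mod int d"
  have "?p ` R \<subseteq> {0..<int d}" using d by (auto intro: mod_in_interval)
  moreover have "card (?p ` R) = card {0..<int d}" using card_image[OF R(1)] R(2) by simp
  ultimately have onto: "?p ` R = {0..<int d}" by (simp add: card_subset_eq)
  define \<rho> where "\<rho> x = inv_into R ?p (?p x)" for x
  have img: "?p x \<in> ?p ` R" for x unfolding onto by (rule mod_in_interval[OF d])
  have 1: "\<rho> x \<in> R" for x unfolding \<rho>_def by (rule inv_into_into[OF img])
  have 2: "[\<rho> x = x] (mod int d)" for x
    using f_inv_into_f[OF img] unfolding \<rho>_def cong_def .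
  have 3: "\<rho> r = r" if "r \<in> R" for r
    unfolding \<rho>_def by (rule inv_into_f_f[OF R(1) that])
  have "\<rho> x = \<rho> y \<longleftrightarrow> [x = y] (mod int d)" for x y
  proof
    assume "\<rho> x = \<rho> y"
    then show "[x = y] (mod int d)" using 2 by (metis cong_sym cong_trans)
  next
    assume "[x = y] (mod int d)"
    then show "\<rho> x = \<rho> y" unfolding \<rho>_def cong_def by simp
  qed
  with 1 2 3 show ?thesis using that by blast
qed

text \<open>Modulo \<open>d\<close>, \<open>R\<close> looks like \<open>{..<d}\<close>, whose
  \<open>m\<close>-subset sums already cover every residue.\<close>

lemma transversal_subset_sums_mod:
  fixes d m :: nat
  assumes R: "inj_on (\<lambda>x. x mod int d) R" "card R = d" and m: "1 \<le> m" "m < d"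
  shows "(\<lambda>s. s mod int d) ` subset_sums (2 * d) R m = {0..<int d}"
proof
  have d: "d > 0" using m by simp
  show "(\<lambda>s. s mod int d) ` subset_sums (2 * d) R m \<subseteq> {0..<int d}"
    using d by auto
  obtain \<rho> where \<rho>: "\<And>x. \<rho> x \<in> R" "\<And>x. [\<rho> x = x] (mod int d)"
    "\<And>x y. \<rho> x = \<rho> y \<longleftrightarrow> [x = y] (mod int d)"
    using transversal_section[OF d R] by metis
  \<comment> \<open>With these, \<open>m * (d - m) + 1\<close> equals
    \<open>d + a * b\<close>.\<close>
  obtain a b where ab: "m = Suc a" "d = Suc a + Suc b"
    using m by (metis Suc_le_D less_imp_Suc_add One_nat_def add_Suc_right)
  have dm: "d \<le> m * (d - m) + 1" unfolding ab by simp
  show "{0..<int d} \<subseteq> (\<lambda>s. s mod int d) ` subset_sums (2 * d) R m"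
  proof
    fix r assume r: "r \<in> {0..<int d}"
    obtain F where F: "F \<subseteq> {..<d}" "card F = m" "[int (\<Sum>F) = r] (mod int d)"
      using ex_consecutive_sum_cong[of m d d r] m d dm by auto
    let ?f = "\<lambda>i. \<rho> (int i)"
    have inj: "inj_on ?f F"
    proof (rule inj_onI)
      fix i j assume ij: "i \<in> F" "j \<in> F" "?f i = ?f j"
      then have "int i mod int d = int j mod int d" unfolding \<rho>(3) cong_def by simp
      moreover have "i < d" "j < d" using ij F(1) by auto
      ultimately show "i = j" by simp
    qed
    have "finite F" using F(1) finite_subset by blast
    then have FR: "?f ` F \<in> nsets R m"
      using \<rho>(1) F(2) by (auto simp: nsets_def card_image[OF inj])
    have "(\<Sum>x\<in>?f ` F. x) = (\<Sum>i\<in>F. ?f i)" by (simp add: sum.reindex[OF inj])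
    moreover have "[(\<Sum>i\<in>F. ?f i) = (\<Sum>i\<in>F. int i)] (mod int d)" by (intro cong_sum \<rho>(2))
    ultimately have "[(\<Sum>x\<in>?f ` F. x) = r] (mod int d)"
      using F(3) cong_trans by fastforce
    then have "(\<Sum>x\<in>?f ` F. x) mod int (2 * d) mod int d = r"
      using r by (simp add: cong_def mod_mod_cancel)
    moreover have "(\<Sum>x\<in>?f ` F. x) mod int (2 * d) \<in> subset_sums (2 * d) R m"
      unfolding subset_sums_def using FR by blast
    ultimately show "r \<in> (\<lambda>s. s mod int d) ` subset_sums (2 * d) R m" by (metis imageI)
  qed
qed

lemma transversal_card_subset_sums_ge:
  fixes d m :: nat
  assumes "inj_on (\<lambda>x. x mod int d) R" "card R = d" "1 \<le> m" "m < d"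
  shows "d \<le> card (subset_sums (2 * d) R m)"
  using card_image_le[OF finite_subset_sums[of "2 * d" R m], of "\<lambda>s. s mod int d"] assms(3,4)
  unfolding transversal_subset_sums_mod[OF assms] by simp

text \<open>
  If the sum of an \<open>m\<close>-subset modulo \<open>d\<close> determines its parity, then exchanging
  \<open>{\<rho> x, \<rho> (x + 3)}\<close> for \<open>{\<rho> (x + 1), \<rho> (x + 2)}\<close> shows that the parity of \<open>\<rho> x + \<rho> (x + 1)\<close>
  is invariant under \<open>x \<mapsto> x + 2\<close>, hence constant as \<open>d\<close> is odd; it is even, since otherwise the
  parities would alternate around a cycle of odd length.
\<close>
lemma transversal_single_parity:
  fixes d m :: nat
  assumes R: "inj_on (\<lambda>x. x mod int d) R" "card R = d" and d: "odd d"
    and m: "2 \<le> m" "m \<le> d - 2" and le: "card (subset_sums (2 * d) R m) \<le> d"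
  shows "\<forall>x\<in>R. \<forall>y\<in>R. even x \<longleftrightarrow> even y"
proof -
  let ?Y = "subset_sums (2 * d) R m"
  have d5: "d \<ge> 5" using d m by (cases "d = 4") auto
  have finR: "finite R" using R(2) d5 by (intro card_ge_0_finite) simp
  have d0: "d > 0" using d5 by simp
  obtain \<rho> where \<rho>: "\<And>x. \<rho> x \<in> R" "\<And>x. [\<rho> x = x] (mod int d)" "\<And>r. r \<in> R \<Longrightarrow> \<rho> r = r"
    "\<And>x y. \<rho> x = \<rho> y \<longleftrightarrow> [x = y] (mod int d)"
    by (rule transversal_section[OF d0 R]) (rule that)
  have "card ((\<lambda>s. s mod int d) ` ?Y) = card ?Y"
    using transversal_card_subset_sums_ge[OF R, of m] le m d5
    by (subst transversal_subset_sums_mod[OF R]) auto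
  \<comment> \<open>\<open>?Y\<close> covers all residues modulo \<open>d\<close> and has no more
    elements than these, so a sum modulo \<open>d\<close> determines the sum modulo
    \<open>2 * d\<close>, hence its parity.\<close>
  then have injY: "inj_on (\<lambda>s. s mod int d) ?Y"
    using finite_subset_sums[of "2 * d" R m] d0 by (intro eq_card_imp_inj_on) simp_all
  have parity: "even (\<Sum>i\<in>F. i) \<longleftrightarrow> even (\<Sum>i\<in>F'. i)"
    if F: "F \<in> nsets R m" "F' \<in> nsets R m" and c: "[(\<Sum>i\<in>F. i) = (\<Sum>i\<in>F'. i)] (mod int d)" for F F'
  proof -
    have Y: "(\<Sum>i\<in>F. i) mod int (2 * d) \<in> ?Y" "(\<Sum>i\<in>F'. i) mod int (2 * d) \<in> ?Y"
      using F unfolding subset_sums_def by (metis imageI)+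
    have "(\<Sum>i\<in>F. i) mod int (2 * d) mod int d = (\<Sum>i\<in>F. i) mod int d" for F :: "int set"
      by (rule mod_mod_cancel) simp
    then have "(\<Sum>i\<in>F. i) mod int (2 * d) mod int d = (\<Sum>i\<in>F'. i) mod int (2 * d) mod int d"
      using c unfolding cong_def by metis
    then have "(\<Sum>i\<in>F. i) mod int (2 * d) = (\<Sum>i\<in>F'. i) mod int (2 * d)"
      using inj_on_eq_iff[OF injY Y] by metis
    then have "2 * int d dvd (\<Sum>i\<in>F. i) - (\<Sum>i\<in>F'. i)" by (simp add: mod_eq_dvd_iff)
    then have "even ((\<Sum>i\<in>F. i) - (\<Sum>i\<in>F'. i))" using dvd_mult_left by blast
    then show ?thesis by simp
  qed
  have ncong: "\<rho> (x + a) \<noteq> \<rho> (x + b)" if "a \<in> {0..3}" "b \<in> {0..3}" "a \<noteq> b" for x a b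
  proof -
    have "0 < \<bar>a - b\<bar>" "\<bar>a - b\<bar> < int d" using that d5 by auto
    then have "\<not> int d dvd a - b" using zdvd_not_zless[of "\<bar>a - b\<bar>" "int d"] by simp
    then show ?thesis unfolding \<rho>(4) by (simp add: cong_iff_dvd_diff)
  qed
  have exch: "even (\<rho> x + \<rho> (x + 3)) \<longleftrightarrow> even (\<rho> (x + 1) + \<rho> (x + 2))" for x
  proof -
    have dist: "\<rho> x \<noteq> \<rho> (x + 1)" "\<rho> x \<noteq> \<rho> (x + 2)" "\<rho> x \<noteq> \<rho> (x + 3)"
      "\<rho> (x + 1) \<noteq> \<rho> (x + 2)" "\<rho> (x + 1) \<noteq> \<rho> (x + 3)" "\<rho> (x + 2) \<noteq> \<rho> (x + 3)"
      using ncong[of 0 1 x] ncong[of 0 2 x] ncong[of 0 3 x] ncong[of 1 2 x] ncong[of 1 3 x]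
        ncong[of 2 3 x] by simp_all
    let ?Q = "{\<rho> x, \<rho> (x + 3), \<rho> (x + 1), \<rho> (x + 2)}"
    have "card (R - ?Q) = card R - card ?Q" using \<rho>(1) by (intro card_Diff_subset) auto
    moreover have "card ?Q = 4" using dist by auto
    \<comment> \<open>The bound \<open>m \<le> d - 2\<close> leaves room for \<open>m - 2\<close>
      common elements outside the four exchanged ones.\<close>
    ultimately have "m - 2 \<le> card (R - ?Q)" using m R(2) by simp
    then obtain C where C: "C \<subseteq> R - ?Q" "card C = m - 2" "finite C"
      using obtain_subset_with_card_n[of "m - 2" "R - ?Q"] by metis
    have pair: "insert (\<rho> (x + a)) (insert (\<rho> (x + b)) C) \<in> nsets R m"
      "(\<Sum>i\<in>insert (\<rho> (x + a)) (insert (\<rho> (x + b)) C). i) = \<rho> (x + a) + \<rho> (x + b) + (\<Sum>i\<in>C. i)"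
      if "\<rho> (x + a) \<in> ?Q" "\<rho> (x + b) \<in> ?Q" "\<rho> (x + a) \<noteq> \<rho> (x + b)" for a b
    proof -
      have notin: "\<rho> (x + a) \<notin> C" "\<rho> (x + b) \<notin> C" using that C(1) by blast+
      have "card (insert (\<rho> (x + a)) (insert (\<rho> (x + b)) C)) = m"
        using notin that(3) C(2,3) m(1) by simp
      then show "insert (\<rho> (x + a)) (insert (\<rho> (x + b)) C) \<in> nsets R m"
        using \<rho>(1) C(1,3) by (auto simp: nsets_def)
      show "(\<Sum>i\<in>insert (\<rho> (x + a)) (insert (\<rho> (x + b)) C). i) = \<rho> (x + a) + \<rho> (x + b) + (\<Sum>i\<in>C. i)"
        using notin that(3) C(3) by simp
    qed
    have A: "\<rho> (x + 0) \<in> ?Q" "\<rho> (x + 3) \<in> ?Q" "\<rho> (x + 0) \<noteq> \<rho> (x + 3)"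
      and B: "\<rho> (x + 1) \<in> ?Q" "\<rho> (x + 2) \<in> ?Q" "\<rho> (x + 1) \<noteq> \<rho> (x + 2)"
      using dist by simp_all
    have "[\<rho> (x + a) + \<rho> (x + b) + (\<Sum>i\<in>C. i) = 2 * x + (a + b) + (\<Sum>i\<in>C. i)] (mod int d)" for a b
      using cong_add[OF cong_add[OF \<rho>(2)[of "x + a"] \<rho>(2)[of "x + b"]] cong_refl[of "\<Sum>i\<in>C. i"]]
      by (simp add: algebra_simps)
    from this[of 0 3] this[of 1 2]
    have "[\<rho> (x + 0) + \<rho> (x + 3) + (\<Sum>i\<in>C. i) = \<rho> (x + 1) + \<rho> (x + 2) + (\<Sum>i\<in>C. i)] (mod int d)"
      by (simp add: cong_def)
    from parity[OF pair(1)[OF A] pair(1)[OF B]] this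
    show ?thesis unfolding pair(2)[OF A] pair(2)[OF B] by (cases "even (\<Sum>i\<in>C. i)") auto
  qed
  define \<Delta> where "\<Delta> x \<longleftrightarrow> even (\<rho> x + \<rho> (x + 1))" for x
  have \<Delta>2: "\<Delta> (x + 2) \<longleftrightarrow> \<Delta> x" for x
    using exch[of x] unfolding \<Delta>_def by (auto simp: add.assoc)
  have \<Delta>2j: "\<Delta> (x + 2 * int j) \<longleftrightarrow> \<Delta> x" for x j
  proof (induction j)
    case (Suc j)
    have eq: "x + 2 * int (Suc j) = (x + 2 * int j) + 2" by simp
    show ?case unfolding eq \<Delta>2 by (rule Suc)
  qed simp
  have per: "\<rho> (x + int d) = \<rho> x" for x unfolding \<rho>(4) by (simp add: cong_def)
  obtain k where k: "d = 2 * k + 1" using d by (elim oddE)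
  have \<Delta>1: "\<Delta> (x + 1) \<longleftrightarrow> \<Delta> x" for x
  proof -
    \<comment> \<open>As \<open>d = 2 * k + 1\<close>, \<open>k + 1\<close> steps of length 2 amount
      to one unit step plus a full period.\<close>
    have eq: "x + 2 * int (k + 1) = x + 1 + int d" using k by simp
    have "\<Delta> (x + 1 + int d) \<longleftrightarrow> \<Delta> (x + 1)"
      using per[of "x + 1"] per[of "x + 1 + 1"] unfolding \<Delta>_def by (simp add: add.commute add.left_commute)
    then show ?thesis using \<Delta>2j[of x "k + 1"] unfolding eq by simp
  qed
  have step: "even (\<rho> (int j)) \<longleftrightarrow> (if \<Delta> 0 then even (\<rho> 0) else even (\<rho> 0) = even j)"
    and "\<Delta> (int j) \<longleftrightarrow> \<Delta> 0" for j
  proof (induction j)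
    case (Suc j)
    have eq: "int (Suc j) = int j + 1" by simp
    { case 1 then show ?case using Suc unfolding eq \<Delta>_def[of "int j"] by auto }
    { case 2 then show ?case using Suc \<Delta>1 unfolding eq by simp }
  qed simp_all
  \<comment> \<open>Otherwise the parities alternate, and going round the odd period
    \<open>d\<close> would give \<open>\<rho> 0\<close> the opposite parity.\<close>
  have "\<Delta> 0" using step[of d] per[of 0] d by (auto split: if_splits)
  have const: "even r \<longleftrightarrow> even (\<rho> 0)" if "r \<in> R" for r
  proof -
    have "\<rho> (int (nat (r mod int d))) = \<rho> r" using d0 unfolding \<rho>(4) by (simp add: cong_def)
    then show ?thesis using step[of "nat (r mod int d)"] \<open>\<Delta> 0\<close> \<rho>(3)[OF that] by simp
  qed
  then show ?thesis by blast
qed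

text \<open>An injection of \<open>R\<close> into the residues of \<open>X\<close> is onto because
  the sizes agree. So points outside \<open>R\<close> miss \<open>X\<close>, and the sums can be
  compared.\<close>

lemma affine_copy:
  fixes \<epsilon> :: int
  assumes X: "X \<subseteq> ground n" and R: "R \<subseteq> ground n" "card R = card X" and \<epsilon>: "\<epsilon> = 1 \<or> \<epsilon> = - 1"
    and sub: "\<And>r. r \<in> R \<Longrightarrow> mem_mod n X (b + \<epsilon> * r)"
  shows "v \<in> ground n - R \<Longrightarrow> \<not> mem_mod n X (b + \<epsilon> * v)"
    and "[(\<Sum>x\<in>X. x) = int (card R) * b + \<epsilon> * (\<Sum>r\<in>R. r)] (mod int n)"
proof -
  let ?f = "\<lambda>r. (b + \<epsilon> * r) mod int n" and ?A = "residues_of n X"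
  have inj: "inj_on ?f (ground n)" by (rule inj_on_shift_ground_mod[OF order_refl \<epsilon>])
  have finA: "finite ?A"
    unfolding residues_of_def using X finite_subset by (intro finite_imageI) fastforce
  have "?f ` R \<subseteq> ?A" using sub unfolding mem_mod_iff by blast
  moreover have "card (?f ` R) = card ?A"
    using card_image[OF inj_on_subset[OF inj R(1)]] card_residues_of[OF X] R(2) by simp
  ultimately have eq: "?f ` R = ?A" using finA by (simp add: card_subset_eq)
  show "\<not> mem_mod n X (b + \<epsilon> * v)" if v: "v \<in> ground n - R"
  proof
    assume "mem_mod n X (b + \<epsilon> * v)"
    then have "?f v \<in> ?f ` R" unfolding mem_mod_iff eq .
    then show False using inj_on_image_mem_iff[OF inj _ R(1), of v] v by simp
  qed
  have "(\<Sum>a\<in>?f ` R. a) = (\<Sum>r\<in>R. ?f r)"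
    by (simp add: sum.reindex[OF inj_on_subset[OF inj R(1)]])
  moreover have "(\<Sum>a\<in>?A. a) = (\<Sum>x\<in>X. x mod int n)"
    unfolding residues_of_def by (simp add: sum.reindex[OF ground_inj_mod[OF X]])
  ultimately have sums: "(\<Sum>r\<in>R. ?f r) = (\<Sum>x\<in>X. x mod int n)" using eq by simp
  have "[(\<Sum>x\<in>X. x) = (\<Sum>x\<in>X. x mod int n)] (mod int n)" by (intro cong_sum) (simp add: cong_def)
  moreover have "[(\<Sum>r\<in>R. ?f r) = (\<Sum>r\<in>R. b + \<epsilon> * r)] (mod int n)"
    by (intro cong_sum) (simp add: cong_def)
  ultimately have "[(\<Sum>x\<in>X. x) = (\<Sum>r\<in>R. b + \<epsilon> * r)] (mod int n)"
    unfolding sums by (rule cong_trans)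
  then show "[(\<Sum>x\<in>X. x) = int (card R) * b + \<epsilon> * (\<Sum>r\<in>R. r)] (mod int n)"
    by (simp add: sum.distrib sum_distrib_left)
qed

section \<open>Almost shattering\<close>

lemma mem_mod_parity:
  assumes "mem_mod (2 * d) X r"
  obtains x where "x \<in> X" "even x \<longleftrightarrow> even r"
proof -
  obtain x where x: "x \<in> X" "[x = r] (mod int (2 * d))" using assms unfolding mem_mod_def by blast
  then have "2 * int d dvd x - r" by (simp add: cong_iff_dvd_diff)
  then have "even (x - r)" using dvd_mult_left by blast
  then show ?thesis using that[OF x(1)] by simp
qed

section \<open>Sufficiency of the three conditions\<close>

text \<open>\<open>c\<close> stands for the sum of the prescribed trace. If all the sums miss
  \<open>X\<close>, their reflections \<open>d - r\<close> lie in \<open>X\<close>, so there are at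
  most \<open>d\<close> subset sums.\<close>

lemma ex_middle_extension:
  fixes c :: int
  assumes d: "d = 2 * k + 1"
    and X: "X \<subseteq> ground (2 * d)" "card X = d" "\<exists>x\<in>X. odd x" "\<exists>x\<in>X. even x"
    and pair: "\<And>r. mem_mod (2 * d) X r \<longleftrightarrow> \<not> mem_mod (2 * d) X (int d - r)"
    and R: "R \<subseteq> ground (2 * d)" "card R = d"
    and m: "2 \<le> m" "m \<le> d - 2"
  shows "\<exists>B\<in>nsets R m. mem_mod (2 * d) X (c + (\<Sum>i\<in>B. i))"
proof (rule ccontr)
  assume none: "\<not> ?thesis"
  let ?n = "2 * d"
  let ?Y = "subset_sums ?n R m" and ?A = "residues_of ?n X"
  let ?f = "\<lambda>s. ((int d - c) + (- 1) * s) mod int ?n"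
  have n: "?n > 0" and odd: "odd d" using d by simp_all
  have f_sum: "?f ((\<Sum>i\<in>B. i) mod int ?n) = (int d - (c + (\<Sum>i\<in>B. i))) mod int ?n" for B
  proof -
    have "((int d - c) + (- 1) * ((\<Sum>i\<in>B. i) mod int ?n)) - (int d - (c + (\<Sum>i\<in>B. i)))
        = (\<Sum>i\<in>B. i) - (\<Sum>i\<in>B. i) mod int ?n" by linarith
    then show ?thesis by (simp only: mod_eq_dvd_iff dvd_minus_mod)
  qed
  have sub: "?f ` ?Y \<subseteq> ?A"
  proof
    fix a assume "a \<in> ?f ` ?Y"
    then obtain B where B: "B \<in> nsets R m" "a = ?f ((\<Sum>i\<in>B. i) mod int ?n)"
      unfolding subset_sums_def by blast
    have "mem_mod ?n X (int d - (c + (\<Sum>i\<in>B. i)))" using none B(1) pair by blast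
    then show "a \<in> ?A" unfolding B(2) f_sum mem_mod_iff .
  qed
  have cA: "card ?A = d" using card_residues_of[OF X(1)] X(2) by simp
  have finA: "finite ?A" using cA n by (intro card_ge_0_finite) simp
  have cf: "card (?f ` ?Y) = card ?Y"
    by (intro card_image inj_on_affine_mod subset_sums_subset[OF n]) simp
  then have le: "card ?Y \<le> d" using card_mono[OF finA sub] cA by simp
  have trans: "inj_on (\<lambda>x. x mod int d) R"
  proof (rule half_set_cases[OF odd R])
    assume "\<And>\<delta>. \<delta> \<in> {1..<int (2 * d)} \<Longrightarrow> \<exists>x\<in>R. \<exists>y\<in>R. [x - y = \<delta>] (mod int (2 * d))"
    then have "d < card ?Y" by (rule card_subset_sums_all_differences[OF d R m])
    with le show ?thesis by simp
  qed
  have par: "\<forall>x\<in>R. \<forall>y\<in>R. even x \<longleftrightarrow> even y"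
    by (rule transversal_single_parity[OF trans R(2) odd m le])
  have "card ?Y = d"
    using transversal_card_subset_sums_ge[OF trans R(2), of m] m le by linarith
  \<comment> \<open>By equality of sizes \<open>X\<close> is exactly the reflected set of sums
    modulo \<open>2 * d\<close>, so a common parity of the sums passes to \<open>X\<close>.\<close>
  then have onto: "?f ` ?Y = ?A" using card_subset_eq[OF finA sub] cf cA by simp
  have "card R \<noteq> 0" using R(2) d by linarith
  then have "R \<noteq> {}" by (metis card.empty)
  then obtain r where "r \<in> R" by blast
  have parB: "even (\<Sum>i\<in>B. i) \<longleftrightarrow> even (int m * r)" if B: "B \<in> nsets R m" for B
  proof -
    have "even (i - r)" if i: "i \<in> B" for i
    proof -
      have "i \<in> R" using i B unfolding nsets_def by blast
      then have "even i \<longleftrightarrow> even r" using par \<open>r \<in> R\<close> by blast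
      then show ?thesis by simp
    qed
    then have "even (\<Sum>i\<in>B. i - r)" by (rule dvd_sum)
    then have "even ((\<Sum>i\<in>B. i) - (\<Sum>i\<in>B. r))" by (simp only: sum_subtractf)
    moreover have "card B = m" using B by (simp add: nsets_def)
    ultimately show ?thesis by simp
  qed
  have "even x \<longleftrightarrow> even (int d - (c + int m * r))" if "x \<in> X" for x
  proof -
    have "x mod int ?n \<in> ?f ` ?Y" using that unfolding onto residues_of_def by blast
    then obtain B where B: "B \<in> nsets R m" "x mod int ?n = ?f ((\<Sum>i\<in>B. i) mod int ?n)"
      unfolding subset_sums_def by blast
    then have "2 * int d dvd x - (int d - (c + (\<Sum>i\<in>B. i)))"
      unfolding f_sum by (simp add: mod_eq_dvd_iff)
    then have "even (x - (int d - (c + (\<Sum>i\<in>B. i))))" using dvd_mult_left by blast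
    then show ?thesis using parB[OF B(1)] by auto
  qed
  then show False using X(3,4) by blast
qed

text \<open>If \<open>T\<close> is not a trace, \<open>X\<close> is a translate of the complement of
  \<open>S\<close> (one-element \<open>T\<close>) or of its negative (\<open>d - 1\<close>
  elements). Either way the sum of \<open>X\<close> is congruent modulo \<open>d\<close> to an
  element of \<open>X\<close>.\<close>

lemma ex_boundary_extension:
  assumes X: "X \<subseteq> ground (2 * d)" "card X = d"
    and pair: "\<And>r. mem_mod (2 * d) X r \<longleftrightarrow> \<not> mem_mod (2 * d) X (int d - r)"
    and sum: "\<And>u. u \<in> X \<Longrightarrow> \<not> [(\<Sum>w\<in>X. w) = u] (mod int d)"
    and S: "S \<in> nsets (ground (2 * d)) d" and T: "T \<subseteq> S" "card T = 1 \<or> card T = d - 1" and d: "d > 1"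
  shows "\<exists>B\<in>nsets (ground (2 * d) - S) (d - card T). mem_mod (2 * d) X ((\<Sum>i\<in>T. i) + (\<Sum>i\<in>B. i))"
proof (rule ccontr)
  assume none: "\<not> ?thesis"
  let ?n = "2 * d" and ?R = "ground (2 * d) - S"
  let ?\<sigma> = "\<Sum>i\<in>?R. i"
  have Sf: "S \<subseteq> ground ?n" "finite S" "card S = d" using S by (simp_all add: nsets_def)
  have R: "?R \<subseteq> ground ?n" "card ?R = d" "finite ?R"
    using complement_nsets(1)[OF S] by (simp_all add: nsets_def)
  have avoid: "mem_mod ?n X (int d - ((\<Sum>i\<in>T. i) + (\<Sum>i\<in>B. i)))" if "B \<in> nsets ?R (d - card T)" for B
    using none that pair by blast
  \<comment> \<open>The point \<open>v\<close> of \<open>S\<close> is mapped outside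
    \<open>X\<close>, so the pairing yields \<open>u\<close> in \<open>X\<close> congruent to
    \<open>d - (b + \<epsilon> * v)\<close>. Modulo \<open>d\<close> the term \<open>d * b\<close>
    in the sum of the copy vanishes, leaving \<open>\<epsilon> * ?\<sigma>\<close>, which is
    \<open>u\<close>.\<close>
  have finish: False
    if \<epsilon>: "\<epsilon> = 1 \<or> \<epsilon> = - 1" and copy: "\<And>r. r \<in> ?R \<Longrightarrow> mem_mod ?n X (b + \<epsilon> * r)"
      and v: "v \<in> S" and eq: "[int d - (b + \<epsilon> * v) = \<epsilon> * ?\<sigma>] (mod int d)" for \<epsilon> b v
  proof -
    have cXR: "card ?R = card X" using R(2) X(2) by simp
    have "v \<in> ground ?n - ?R" using v Sf(1) by auto
    then have "mem_mod ?n X (int d - (b + \<epsilon> * v))"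
      using affine_copy(1)[OF X(1) R(1) cXR \<epsilon> copy] pair by blast
    then obtain u where u: "u \<in> X" "[u = int d - (b + \<epsilon> * v)] (mod int ?n)"
      unfolding mem_mod_def by blast
    have "[u = int d - (b + \<epsilon> * v)] (mod int d)" by (rule cong_dvd_modulus[OF u(2)]) simp
    then have u\<sigma>: "[u = \<epsilon> * ?\<sigma>] (mod int d)" using eq by (rule cong_trans)
    have "[(\<Sum>x\<in>X. x) = int (card ?R) * b + \<epsilon> * ?\<sigma>] (mod int ?n)"
      by (rule affine_copy(2)[OF X(1) R(1) cXR \<epsilon> copy])
    then have "[(\<Sum>x\<in>X. x) = int d * b + \<epsilon> * ?\<sigma>] (mod int d)"
      unfolding R(2) by (rule cong_dvd_modulus) simp
    then have "[(\<Sum>x\<in>X. x) = u] (mod int d)" using u\<sigma> by (simp add: cong_def)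
    then show False using sum[OF u(1)] by blast
  qed
  from T(2) show False
  proof
    assume "card T = 1"
    then obtain v where v: "T = {v}" by (auto simp: card_1_singleton_iff)
    show False
    \<comment> \<open>Here \<open>B\<close> omits a single \<open>r\<close> from the complement, so
      the sum to be reflected is \<open>v + ?\<sigma> - r\<close>.\<close>
    proof (rule finish[of 1 "int d - v - ?\<sigma>" v])
      fix r assume r: "r \<in> ?R"
      then have "?R - {r} \<in> nsets ?R (d - card T)" using R v by (auto simp: nsets_def)
      from avoid[OF this] show "mem_mod ?n X (int d - v - ?\<sigma> + 1 * r)"
        using r R(3) v by (simp add: sum_diff1 algebra_simps)
    qed (use v T(1) in simp_all)
  next
    assume cT: "card T = d - 1"
    then have "card (S - T) = 1" using T(1) Sf d finite_subset[OF T(1) Sf(2)] by (simp add: card_Diff_subset)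
    then obtain s where s: "S - T = {s}" by (auto simp: card_1_singleton_iff)
    have "(\<Sum>i\<in>S. i) = (\<Sum>i\<in>T. i) + (\<Sum>i\<in>S - T. i)"
      using sum.subset_diff[OF T(1) Sf(2), of "\<lambda>i. i"] by simp
    then have \<sigma>T: "(\<Sum>i\<in>T. i) = (\<Sum>i\<in>S. i) - s" using s by simp
    have "[?\<sigma> = int d - (\<Sum>i\<in>S. i)] (mod int d)"
      by (rule cong_dvd_modulus[OF complement_nsets(2)[OF S]]) simp
    then have "int d dvd (?\<sigma> + (\<Sum>i\<in>S. i)) - int d" by (simp add: cong_iff_dvd_diff algebra_simps)
    from dvd_add[OF this dvd_refl] have dvd: "int d dvd (\<Sum>i\<in>S. i) + ?\<sigma>"
      by (simp add: add.commute)
    show False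
    \<comment> \<open>Here \<open>B\<close> is a single \<open>{r}\<close>. Adding \<open>s\<close>
      to the sum of \<open>T\<close> gives the sum of \<open>S\<close>, which is
      \<open>- ?\<sigma>\<close> modulo \<open>d\<close>.\<close>
    proof (rule finish[of "- 1" "int d - (\<Sum>i\<in>T. i)" s])
      fix r assume r: "r \<in> ?R"
      then have "{r} \<in> nsets ?R (d - card T)" using cT d by (auto simp: nsets_def)
      from avoid[OF this] show "mem_mod ?n X (int d - (\<Sum>i\<in>T. i) + - 1 * r)"
        by (simp add: algebra_simps)
    next
      show "[int d - (int d - (\<Sum>i\<in>T. i) + - 1 * s) = - 1 * ?\<sigma>] (mod int d)"
        using dvd unfolding \<sigma>T by (simp add: cong_iff_dvd_diff)
    qed (use s in auto)
  qed
qed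

lemma sum_remove_cong_zero_iff:
  fixes X :: "int set"
  assumes "finite X" "u \<in> X"
  shows "[(\<Sum>w\<in>X - {u}. w) = 0] (mod m) \<longleftrightarrow> [(\<Sum>w\<in>X. w) = u] (mod m)"
  using assms by (simp add: sum_diff1 cong_iff_dvd_diff)

text \<open>Traces of size 1 or \<open>d - 1\<close> rest on the sum condition, the other nonempty
  proper ones on both parities occurring in \<open>X\<close>; the pairing selects one of
  \<open>{}\<close> and \<open>S\<close>.\<close>

lemma almost_shatters_if:
  assumes d: "d = 2 * k + 1" "k \<ge> 1"
    and X: "X \<subseteq> ground (2 * d)" "card X = d" "\<exists>x\<in>X. odd x" "\<exists>x\<in>X. even x"
    and pair: "\<And>r. mem_mod (2 * d) X r \<longleftrightarrow> \<not> mem_mod (2 * d) X (int d - r)"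
    and sum: "\<And>u. u \<in> X \<Longrightarrow> \<not> [(\<Sum>w\<in>X. w) = u] (mod int d)"
    and S: "S \<in> nsets (ground (2 * d)) d"
  shows "almost_shatters (sum_family d X) S"
proof -
  let ?F = "restrict_family (sum_family d X) S"
  let ?R = "ground (2 * d) - S"
  have Sf: "finite S" "card S = d" using S by (simp_all add: nsets_def)
  have R: "?R \<subseteq> ground (2 * d)" "card ?R = d"
    using complement_nsets(1)[OF S] by (simp_all add: nsets_def)
  have middle: "T \<in> ?F" if T: "T \<subseteq> S" "T \<noteq> {}" "T \<noteq> S" for T
  proof -
    have finT: "finite T" using T(1) Sf(1) by (rule finite_subset)
    have c0: "card T > 0" using finT T(2) by (simp add: card_gt_0_iff)
    have cd: "card T < d" using psubset_card_mono[OF Sf(1), of T] T Sf(2) by blast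
    show ?thesis
    proof (cases "card T = 1 \<or> card T = d - 1")
      case True
      have "d > 1" using d by simp
      show ?thesis
        unfolding restrict_sum_family_iff[OF S T(1)]
        by (rule ex_boundary_extension[OF X(1,2) pair sum S T(1) True \<open>d > 1\<close>])
    next
      case False
      then have m: "2 \<le> d - card T" "d - card T \<le> d - 2" using c0 cd by linarith+
      show ?thesis
        unfolding restrict_sum_family_iff[OF S T(1)]
        by (rule ex_middle_extension[OF d(1) X pair R m])
    qed
  qed
  have xor: "S \<in> ?F \<longleftrightarrow> {} \<notin> ?F"
    using whole_in_restrict_iff[OF S] empty_in_restrict_iff[OF S] pair by blast
  show ?thesis
  proof (cases "S \<in> ?F")
    case True
    then have "?F = Pow S - {{}}"
      using xor middle restrict_family_subset[of "sum_family d X" S] by blast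
    then show ?thesis unfolding almost_shatters_def by blast
  next
    case False
    then have "?F = Pow S - {S}"
      using xor middle restrict_family_subset[of "sum_family d X" S] by blast
    then show ?thesis unfolding almost_shatters_def by blast
  qed
qed

section \<open>Necessity of the three conditions\<close>

lemma almost_shatters_proper:
  assumes "almost_shatters \<F> S" "T \<subseteq> S" "T \<noteq> {}" "T \<noteq> S"
  shows "T \<in> restrict_family \<F> S"
  using assms unfolding almost_shatters_def by blast

text \<open>For an \<open>S\<close> with sum congruent to \<open>r\<close>, exactly one of
  \<open>S\<close> and \<open>{}\<close> is a trace; these correspond to \<open>r\<close> and
  \<open>d - r\<close>.\<close>

lemma almost_shatters_pair:
  assumes d: "d \<ge> 1" and sh: "\<forall>S\<in>nsets (ground (2 * d)) d. almost_shatters (sum_family d X) S"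
  shows "mem_mod (2 * d) X r \<longleftrightarrow> \<not> mem_mod (2 * d) X (int d - r)"
proof -
  obtain S where S: "S \<in> nsets (ground (2 * d)) d" "[(\<Sum>i\<in>S. i) = r] (mod int (2 * d))"
    using ex_nsets_ground_sum[OF d] by blast
  have "S \<noteq> {}" using S(1) d by (auto simp: nsets_def)
  then have "S \<in> restrict_family (sum_family d X) S \<longleftrightarrow> {} \<notin> restrict_family (sum_family d X) S"
    using sh S(1) unfolding almost_shatters_def by fastforce
  moreover have "[int d - (\<Sum>i\<in>S. i) = int d - r] (mod int (2 * d))"
    using S(2) by (intro cong_diff cong_refl)
  ultimately show ?thesis
    unfolding whole_in_restrict_iff[OF S(1)] empty_in_restrict_iff[OF S(1)]
    using mem_mod_cong[OF S(2)] mem_mod_cong by blast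
qed

text \<open>Let \<open>S\<close> consist of the odd elements of the ground set. The complement is
  even, so the sum of a member has the parity of the sum of its trace; \<open>{1}\<close> and
  \<open>{1, 3}\<close> are proper subsets realising both parities.\<close>

lemma almost_shatters_ex_parity:
  fixes e :: int
  assumes d: "d = 2 * k + 1" "k \<ge> 1"
    and sh: "\<forall>S\<in>nsets (ground (2 * d)) d. almost_shatters (sum_family d X) S"
  shows "\<exists>x\<in>X. even x \<longleftrightarrow> even e"
proof -
  define S where "S = (\<lambda>i. 2 * int i + 1) ` {..<d}"
  define T :: "int set" where "T = (if even e then {1, 3} else {1})"
  have "card S = d" unfolding S_def by (subst card_image) (auto simp: inj_on_def)
  moreover have "S \<subseteq> ground (2 * d)" unfolding S_def ground_def by auto
  ultimately have S: "S \<in> nsets (ground (2 * d)) d" unfolding S_def by (auto simp: nsets_def)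
  have "2 * int 0 + 1 \<in> S" "2 * int 1 + 1 \<in> S"
    unfolding S_def using d by (intro imageI; simp)+
  then have TS: "T \<subseteq> S" unfolding T_def by simp
  have "card T < d" unfolding T_def using d by simp
  then have "T \<noteq> S" using \<open>card S = d\<close> by auto
  moreover have "T \<noteq> {}" unfolding T_def by simp
  ultimately have "T \<in> restrict_family (sum_family d X) S"
    using almost_shatters_proper sh S TS by blast
  then obtain B where B: "B \<in> nsets (ground (2 * d) - S) (d - card T)"
    "mem_mod (2 * d) X ((\<Sum>i\<in>T. i) + (\<Sum>i\<in>B. i))"
    unfolding restrict_sum_family_iff[OF S TS] by blast
  have "even i" if "i \<in> B" for i
  proof (rule ccontr)
    assume "odd i"
    then obtain j where j: "i = 2 * j + 1" by (elim oddE)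
    have "i \<in> ground (2 * d) - S" using that B(1) unfolding nsets_def by blast
    then have "nat j < d" "i = 2 * int (nat j) + 1" "i \<notin> S" unfolding ground_def j by auto
    then show False unfolding S_def by blast
  qed
  then have "even (\<Sum>i\<in>B. i)" by (rule dvd_sum)
  moreover have "even (\<Sum>i\<in>T. i) \<longleftrightarrow> even e" unfolding T_def by simp
  ultimately have "even ((\<Sum>i\<in>T. i) + (\<Sum>i\<in>B. i)) \<longleftrightarrow> even e" by simp
  then show ?thesis using mem_mod_parity[OF B(2)] by metis
qed

text \<open>If the congruence held, the complement \<open>S\<close> of some translate of
  \<open>X\<close> would contain a point \<open>v\<close> such that every \<open>d\<close>-set with
  trace \<open>{v}\<close> has sum congruent to \<open>d - x\<close> for some \<open>x\<close> in
  \<open>X\<close>. The pairing keeps these sums out of \<open>X\<close>, so \<open>{v}\<close> is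
  not a trace.\<close>

lemma almost_shatters_sum_not_cong:
  assumes d: "d > 1" and X: "X \<subseteq> ground (2 * d)" "card X = d"
    and sh: "\<forall>S\<in>nsets (ground (2 * d)) d. almost_shatters (sum_family d X) S"
    and u: "u \<in> X"
  shows "\<not> [(\<Sum>w\<in>X. w) = u] (mod int d)"
proof
  assume "[(\<Sum>w\<in>X. w) = u] (mod int d)"
  let ?n = "2 * d"
  have n: "?n > 0" using d by simp
  have pair: "mem_mod ?n X r \<longleftrightarrow> \<not> mem_mod ?n X (int d - r)" for r
    using d sh by (intro almost_shatters_pair) simp_all
  obtain c where c: "(\<Sum>w\<in>X. w) = u + int d * c"
    using \<open>[(\<Sum>w\<in>X. w) = u] (mod int d)\<close> by (metis cong_iff_lin cong_sym mult.commute)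
  (* A translate of X by c makes the sum of the complement of S equal to u modulo 2d, not only modulo d. *)
  define g where "g x = (SOME y. y \<in> ground ?n \<and> [y = x + c] (mod int ?n))" for x
  have g: "g x \<in> ground ?n" "[g x = x + c] (mod int ?n)" for x
    using someI_ex[of "\<lambda>y. y \<in> ground ?n \<and> [y = x + c] (mod int ?n)"] ex_ground_cong[OF n]
    unfolding g_def by metis+
  have g_eq: "[x = y] (mod int ?n)" if "g x = g y" for x y
  proof -
    have "[x + c = y + c] (mod int ?n)" using g(2) that by (metis cong_sym cong_trans)
    then show ?thesis by (simp add: cong_iff_dvd_diff)
  qed
  have inj: "inj_on g X" using g_eq X(1) ground_cong_eq by (meson inj_onI subsetD)
  define R where "R = g ` X"
  have "card R = d" unfolding R_def using inj X(2) by (simp add: card_image)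
  then have R: "R \<in> nsets (ground ?n) d"
    unfolding nsets_def R_def using g(1) d by (auto intro: card_ge_0_finite)
  define S where "S = ground ?n - R"
  have S: "S \<in> nsets (ground ?n) d" unfolding S_def by (rule complement_nsets(1)[OF R])
  have SR: "ground ?n - S = R" using R unfolding S_def nsets_def by blast
  have \<sigma>R: "[(\<Sum>i\<in>R. i) = u] (mod int ?n)"
  proof -
    have "(\<Sum>i\<in>R. i) = (\<Sum>x\<in>X. g x)" unfolding R_def by (simp add: sum.reindex[OF inj])
    also have "[(\<Sum>x\<in>X. g x) = (\<Sum>x\<in>X. x + c)] (mod int ?n)" by (intro cong_sum g(2))
    \<comment> \<open>The \<open>d\<close> copies of \<open>c\<close> double the multiple
      \<open>d * c\<close> that separates the sum of \<open>X\<close> from \<open>u\<close>.\<close>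
    also have "(\<Sum>x\<in>X. x + c) = u + int ?n * c" using X(2) by (simp add: sum.distrib c)
    also have "[u + int ?n * c = u] (mod int ?n)" by (simp add: cong_def)
    finally show ?thesis .
  qed
  \<comment> \<open>Chosen so that \<open>v + u - (x + c)\<close> is \<open>d - x\<close> modulo
    \<open>2 * d\<close>. If \<open>v\<close> were in \<open>R\<close>, both \<open>u\<close> and
    \<open>d - u\<close> would be in \<open>X\<close>.\<close>
  obtain v where v: "v \<in> ground ?n" "[v = int d - u + c] (mod int ?n)" using ex_ground_cong[OF n] .
  have memX: "mem_mod ?n X x" if "x \<in> X" for x using that unfolding mem_mod_def by (meson cong_refl)
  have "v \<notin> R"
  proof
    assume "v \<in> R"
    then obtain x where x: "x \<in> X" "v = g x" unfolding R_def by blast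
    then have "[x + c = int d - u + c] (mod int ?n)" using g(2)[of x] v(2) by (metis cong_sym cong_trans)
    then have "[x = int d - u] (mod int ?n)" by (simp add: cong_iff_dvd_diff)
    then have "mem_mod ?n X (int d - u)" using x(1) unfolding mem_mod_def by blast
    then show False using pair[of u] memX[OF u] by blast
  qed
  then have TS: "{v} \<subseteq> S" using v(1) unfolding S_def by blast
  have "card S = d" using S by (simp add: nsets_def)
  then have "{v} \<noteq> S" using d by auto
  then have "{v} \<in> restrict_family (sum_family d X) S"
    using almost_shatters_proper sh S TS by blast
  then obtain B where B: "B \<in> nsets R (d - 1)" "mem_mod ?n X (v + (\<Sum>i\<in>B. i))"
    unfolding restrict_sum_family_iff[OF S TS] SR by auto
  have finR: "finite R" using R by (simp add: nsets_def)
  have "card (R - B) = 1"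
    using B(1) \<open>card R = d\<close> d by (simp add: nsets_def card_Diff_subset)
  then obtain r where r: "R - B = {r}" by (auto simp: card_1_singleton_iff)
  then obtain x where x: "x \<in> X" "r = g x" unfolding R_def by blast
  have "B \<subseteq> R" using B(1) by (simp add: nsets_def)
  then have "(\<Sum>i\<in>R. i) = r + (\<Sum>i\<in>B. i)"
    using sum.subset_diff[OF _ finR, of B "\<lambda>i. i"] r by simp
  then have eq: "v + (\<Sum>i\<in>B. i) = v + (\<Sum>i\<in>R. i) - g x" unfolding x(2) by simp
  have "[v + (\<Sum>i\<in>R. i) - g x = (int d - u + c) + u - (x + c)] (mod int ?n)"
    by (intro cong_diff cong_add v(2) \<sigma>R g(2))
  moreover have "(int d - u + c) + u - (x + c) = int d - x" by simp
  ultimately have "[v + (\<Sum>i\<in>B. i) = int d - x] (mod int ?n)" unfolding eq by simp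
  then have "mem_mod ?n X (int d - x)" using B(2) mem_mod_cong by blast
  then show False using pair[of x] memX[OF x(1)] by blast
qed

theorem theorem4:
  fixes k d :: nat and X :: "int set"
  assumes "k \<ge> 1"
    and "d = 2 * k + 1"
    and "X \<subseteq> ground (2 * d)"
  shows "(\<forall>S \<in> nsets (ground (2 * d)) d. almost_shatters (sum_family d X) S) \<longleftrightarrow>
    (card X = d \<and>
       residues_of (2 * d) X \<inter> residues_of (2 * d) ((\<lambda>x. int d - x) ` X) = {}) \<and>
    ((\<exists>x\<in>X. odd x) \<and> (\<exists>x\<in>X. even x)) \<and>
    (\<forall>u\<in>X. \<not> [(\<Sum>w\<in>X - {u}. w) = 0] (mod int d))"
proof -
  have d: "d > 0" "d \<ge> 1" "d > 1" using assms(1,2) by simp_all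
  have finX: "finite X" using finite_subset[OF assms(3)] by simp
  note pair_iff = pair_condition_iff[OF assms(3) d(1)]
  show ?thesis
  proof (intro iffI conjI)
    assume sh: "\<forall>S \<in> nsets (ground (2 * d)) d. almost_shatters (sum_family d X) S"
    have pair: "\<forall>r. mem_mod (2 * d) X r \<longleftrightarrow> \<not> mem_mod (2 * d) X (int d - r)"
      using almost_shatters_pair[OF d(2) sh] by blast
    then show cX: "card X = d"
      and "residues_of (2 * d) X \<inter> residues_of (2 * d) ((\<lambda>x. int d - x) ` X) = {}"
      unfolding pair_iff[symmetric] by simp_all
    show "\<exists>x\<in>X. odd x" "\<exists>x\<in>X. even x"
      using almost_shatters_ex_parity[OF assms(2,1) sh, of 1]
        almost_shatters_ex_parity[OF assms(2,1) sh, of 0] by simp_all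
    show "\<forall>u\<in>X. \<not> [(\<Sum>w\<in>X - {u}. w) = 0] (mod int d)"
      using almost_shatters_sum_not_cong[OF d(3) assms(3) cX sh]
        sum_remove_cong_zero_iff[OF finX] by blast
  next
    assume R: "(card X = d \<and>
       residues_of (2 * d) X \<inter> residues_of (2 * d) ((\<lambda>x. int d - x) ` X) = {}) \<and>
      ((\<exists>x\<in>X. odd x) \<and> (\<exists>x\<in>X. even x)) \<and>
      (\<forall>u\<in>X. \<not> [(\<Sum>w\<in>X - {u}. w) = 0] (mod int d))"
    then have pair: "mem_mod (2 * d) X r \<longleftrightarrow> \<not> mem_mod (2 * d) X (int d - r)" for r
      unfolding pair_iff by blast
    have sum: "\<not> [(\<Sum>w\<in>X. w) = u] (mod int d)" if "u \<in> X" for u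
      using R that sum_remove_cong_zero_iff[OF finX that] by blast
    show "\<forall>S \<in> nsets (ground (2 * d)) d. almost_shatters (sum_family d X) S"
      using almost_shatters_if[OF assms(2,1,3) _ _ _ pair sum] R by blast
  qed
qed

end
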